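(* Let $\Phi=(\phi_j)_{j=1}^n$ be a collection of vectors in a non-isotropic space $V$ with $\langle\phi_j,\phi_j\rangle=a$ for all $j$, let $d:=\dim(\operatorname{im}\Phi)$, and suppose $\frac{na}{d}\neq 0$ in $\mathbb{F}$. If $\operatorname{Char}\mathbb{F}>d$ and $(\Phi^\dagger\Phi)^2=\frac{na}{d}\Phi^\dagger\Phi$, then $\operatorname{im}\Phi$ is non-isotropic and $\Phi$ is an $\frac{na}{d}$-tight frame for $\operatorname{im}\Phi$.
   Context: $\mathbb{F}$ is a field with an involution $\sigma$ (possibly the identity). A non-isotropic space is a finite-dimensional $\mathbb{F}$-vector space with a non-degenerate Hermitian scalar product $\langle\cdot,\cdot\rangle$ (linear in the second argument, $\langle u,v\rangle=\langle v,u\rangle^\sigma$, non-degenerate); a subspace is non-isotropic if the restricted form is non-degenerate. $\mathbb{F}^n$ carries $\langle x,y\rangle=\sum_ix_i^\sigma y_i$. The synthesis operator of $\Phi$ is $\Phi:\mathbb{F}^n\to V$, $x\mapsto\sum_jx_j\phi_j$, with adjoint $\Phi^\dagger v=(\langle\phi_j,v\rangle)_j$, so $\Phi^\dagger\Phi=[\langle\phi_j,\phi_k\rangle]_{j,k}$. $\Phi$ is a $c$-tight frame for a non-isotropic subspace $U$ if its vectors span $U$ and $\Phi\Phi^\dagger u=cu$ for all $u\in U$. Integers and fractions are interpreted in $\mathbb{F}$ via $\mathbb{Z}\to\mathbb{F}$. *)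

theory Defs
  imports "HOL-Analysis.Analysis"
begin

definition field_involution :: "('f::field \<Rightarrow> 'f) \<Rightarrow> bool" where
  "field_involution \<sigma> \<longleftrightarrow>
     (\<forall>x y. \<sigma> (x + y) = \<sigma> x + \<sigma> y) \<and> (\<forall>x y. \<sigma> (x * y) = \<sigma> x * \<sigma> y) \<and>
     \<sigma> 1 = 1 \<and> (\<forall>x. \<sigma> (\<sigma> x) = x)"

text \<open>The parameter \<open>Basis\<close> of the library locale only witnesses finite dimensionality; it
  bears no relation to the form.  By Hermitian symmetry, one-sided non-degeneracy is two-sided.\<close>

locale non_isotropic_space = finite_dimensional_vector_space smul Basis
  for smul :: "'f::field \<Rightarrow> 'v::ab_group_add \<Rightarrow> 'v" and Basis :: "'v set" +
  fixes \<sigma> :: "'f \<Rightarrow> 'f" and ip :: "'v \<Rightarrow> 'v \<Rightarrow> 'f"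
  assumes involution: "field_involution \<sigma>"
    and ip_add_right: "ip u (v + w) = ip u v + ip u w"
    and ip_scale_right: "ip u (smul c v) = c * ip u v"
    and ip_hermitian: "ip u v = \<sigma> (ip v u)"
    and ip_nondegenerate: "(\<forall>v. ip u v = 0) \<Longrightarrow> u = 0"

definition non_isotropic_subspace ::
    "('f::field \<Rightarrow> 'v::ab_group_add \<Rightarrow> 'v) \<Rightarrow> ('v \<Rightarrow> 'v \<Rightarrow> 'f) \<Rightarrow> 'v set \<Rightarrow> bool" where
  "non_isotropic_subspace smul ip U \<longleftrightarrow>
     module.subspace smul U \<and> (\<forall>u\<in>U. (\<forall>v\<in>U. ip u v = 0) \<longrightarrow> u = 0)"

definition std_ip :: "('f::field \<Rightarrow> 'f) \<Rightarrow> 'f ^ 'n::finite \<Rightarrow> 'f ^ 'n \<Rightarrow> 'f" where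
  "std_ip \<sigma> x y = (\<Sum>i\<in>UNIV. \<sigma> (x $ i) * y $ i)"

definition synthesis ::
    "('f::field \<Rightarrow> 'v::ab_group_add \<Rightarrow> 'v) \<Rightarrow> ('n::finite \<Rightarrow> 'v) \<Rightarrow> 'f ^ 'n \<Rightarrow> 'v" where
  "synthesis smul \<phi> x = (\<Sum>j\<in>UNIV. smul (x $ j) (\<phi> j))"

definition synthesis_adjoint ::
    "('v \<Rightarrow> 'v \<Rightarrow> 'f::field) \<Rightarrow> ('n::finite \<Rightarrow> 'v) \<Rightarrow> 'v \<Rightarrow> 'f ^ 'n" where
  "synthesis_adjoint ip \<phi> v = (\<chi> j. ip (\<phi> j) v)"

definition gram_operator ::
    "('f::field \<Rightarrow> 'v::ab_group_add \<Rightarrow> 'v) \<Rightarrow> ('v \<Rightarrow> 'v \<Rightarrow> 'f) \<Rightarrow> ('n::finite \<Rightarrow> 'v) \<Rightarrow>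
      'f ^ 'n \<Rightarrow> 'f ^ 'n" where
  "gram_operator smul ip \<phi> = synthesis_adjoint ip \<phi> \<circ> synthesis smul \<phi>"

definition frame_operator ::
    "('f::field \<Rightarrow> 'v::ab_group_add \<Rightarrow> 'v) \<Rightarrow> ('v \<Rightarrow> 'v \<Rightarrow> 'f) \<Rightarrow> ('n::finite \<Rightarrow> 'v) \<Rightarrow>
      'v \<Rightarrow> 'v" where
  "frame_operator smul ip \<phi> = synthesis smul \<phi> \<circ> synthesis_adjoint ip \<phi>"

definition tight_frame ::
    "('f::field \<Rightarrow> 'v::ab_group_add \<Rightarrow> 'v) \<Rightarrow> ('v \<Rightarrow> 'v \<Rightarrow> 'f) \<Rightarrow> ('n::finite \<Rightarrow> 'v) \<Rightarrow>
      'f \<Rightarrow> 'v set \<Rightarrow> bool" where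
  "tight_frame smul ip \<phi> c U \<longleftrightarrow>
     non_isotropic_subspace smul ip U \<and> module.span smul (range \<phi>) = U \<and>
     (\<forall>u\<in>U. frame_operator smul ip \<phi> u = smul c u)"

context non_isotropic_space
begin

lemma ip_zero_right: "ip u 0 = 0"
  by (metis add_0 add_cancel_right_right ip_add_right)

lemma ip_sum_right: "ip u (\<Sum>i\<in>A. f i) = (\<Sum>i\<in>A. ip u (f i))"
  by (induction A rule: infinite_finite_induct) (simp_all add: ip_zero_right ip_add_right)

lemma sigma_add: "\<sigma> (x + y) = \<sigma> x + \<sigma> y" and sigma_mult: "\<sigma> (x * y) = \<sigma> x * \<sigma> y"
  using involution unfolding field_involution_def by blast+

lemma sigma_sum: "\<sigma> (\<Sum>i\<in>A. f i) = (\<Sum>i\<in>A. \<sigma> (f i))"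
proof -
  have "\<sigma> 0 = 0" by (metis add_0 add_cancel_right_right sigma_add)
  then show ?thesis
    by (induction A rule: infinite_finite_induct) (simp_all add: sigma_add)
qed

lemma synthesis_adjoint: "std_ip \<sigma> x (synthesis_adjoint ip \<phi> v) = ip (synthesis smul \<phi> x) v"
proof -
  have "ip (synthesis smul \<phi> x) v = \<sigma> (ip v (synthesis smul \<phi> x))"
    by (rule ip_hermitian)
  also have "\<dots> = (\<Sum>j\<in>UNIV. \<sigma> (x $ j) * \<sigma> (ip v (\<phi> j)))"
    by (simp add: synthesis_def ip_sum_right ip_scale_right sigma_sum sigma_mult)
  also have "\<dots> = (\<Sum>j\<in>UNIV. \<sigma> (x $ j) * ip (\<phi> j) v)"
    by (simp add: ip_hermitian[symmetric])
  finally show ?thesis by (simp add: std_ip_def synthesis_adjoint_def)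
qed

lemma gram_operator_matrix: "gram_operator smul ip \<phi> x = (\<chi> j k. ip (\<phi> j) (\<phi> k)) *v x"
  by (simp add: gram_operator_def synthesis_def synthesis_adjoint_def ip_sum_right ip_scale_right
      matrix_vector_mult_def vec_eq_iff mult.commute)

end

end

theory Submission
  imports Defs
begin

text \<open>Let \<open>U\<close> be the image of \<open>\<Phi>\<close> and \<open>K\<close> the kernel of \<open>\<Phi>\<^sup>\<dagger>\<close> on \<open>U\<close>. The hypothesis on the Gram
  matrix says that the frame operator \<open>S = \<Phi>\<Phi>\<^sup>\<dagger>\<close> maps \<open>U\<close> to \<open>U\<close> with \<open>S u - c u \<in> K\<close>, and \<open>S\<close>
  vanishes on \<open>K\<close>. Reading off the trace of \<open>S\<close> on \<open>U\<close> in a basis extending one of \<open>K\<close> gives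
  \<open>c (d - dim K)\<close>. This trace is also the trace of the Gram matrix, \<open>n a = c d\<close>, so \<open>dim K = 0\<close>
  in the field; as \<open>dim K \<le> d\<close> is below the characteristic, \<open>K = 0\<close>. Hence \<open>S = c\<close> on \<open>U\<close>, and
  a vector of \<open>U\<close> orthogonal to \<open>U\<close> lies in \<open>K\<close>.\<close>

context non_isotropic_space
begin

lemma ip_diff_right: "ip u (v - w) = ip u v - ip u w"
  by (metis add_diff_cancel_right' diff_add_cancel ip_add_right)

lemma synthesis_axis: "synthesis smul \<phi> (axis j 1) = \<phi> j"
proof -
  have "synthesis smul \<phi> (axis j 1) = (\<Sum>i\<in>UNIV. if i = j then \<phi> i else 0)"
    unfolding synthesis_def by (intro sum.cong) (auto simp: axis_def)
  then show ?thesis by simp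
qed

lemma synthesis_in_span: "synthesis smul \<phi> x \<in> span (range \<phi>)"
  unfolding synthesis_def by (intro span_sum span_scale span_base) simp

text \<open>The image is a subspace, and standard basis vectors go to the \<open>\<phi> j\<close>.
  This supplies preimages for vectors of the span and lets the dimension of the image be computed
  from \<open>range \<phi>\<close>.\<close>

lemma range_synthesis: "range (synthesis smul \<phi>) = span (range \<phi>)"
proof
  show "range (synthesis smul \<phi>) \<subseteq> span (range \<phi>)"
    using synthesis_in_span by blast
  have "subspace (range (synthesis smul \<phi>))"
  proof (rule subspaceI)
    have "synthesis smul \<phi> 0 = 0" by (simp add: synthesis_def)
    then show "0 \<in> range (synthesis smul \<phi>)" by (metis rangeI)
  next
    fix u v assume "u \<in> range (synthesis smul \<phi>)" "v \<in> range (synthesis smul \<phi>)"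
    then obtain x y where "u = synthesis smul \<phi> x" "v = synthesis smul \<phi> y" by blast
    then have "u + v = synthesis smul \<phi> (x + y)"
      by (simp add: synthesis_def scale_left_distrib sum.distrib)
    then show "u + v \<in> range (synthesis smul \<phi>)" by blast
  next
    fix r u assume "u \<in> range (synthesis smul \<phi>)"
    then obtain x where "u = synthesis smul \<phi> x" by blast
    then have "smul r u = synthesis smul \<phi> (r *s x)"
      by (simp add: synthesis_def scale_sum_right)
    then show "smul r u \<in> range (synthesis smul \<phi>)" by blast
  qed
  moreover have "range \<phi> \<subseteq> range (synthesis smul \<phi>)"
    by (metis image_subsetI rangeI synthesis_axis)
  ultimately show "span (range \<phi>) \<subseteq> range (synthesis smul \<phi>)"
    by (rule span_minimal[rotated])
qed

lemma frame_operator_sum: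
  "frame_operator smul ip \<phi> u = (\<Sum>j\<in>UNIV. smul (ip (\<phi> j) u) (\<phi> j))"
  by (simp add: frame_operator_def synthesis_def synthesis_adjoint_def)

lemma frame_operator_in_span: "frame_operator smul ip \<phi> u \<in> span (range \<phi>)"
  by (simp add: frame_operator_def synthesis_in_span)

text \<open>An instance of tr(XY) = tr(YX): once each \<open>\<phi> k\<close> is expanded in
  \<open>B\<close>, both sides are the same double sum over \<open>k\<close> and
  \<open>b\<close>.\<close>

lemma gram_trace_eq_frame_trace:
  assumes B: "independent B" "span (range \<phi>) = span B"
  shows "(\<Sum>k\<in>UNIV. ip (\<phi> k) (\<phi> k)) =
    (\<Sum>b\<in>B. representation B (frame_operator smul ip \<phi> b) b)"
proof -
  have mem: "\<phi> k \<in> span B" for k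
    using B(2) by (metis rangeI span_base)
  have fin: "finite B"
    using B(1) by (rule finiteI_independent)
  have "ip (\<phi> k) (\<phi> k) = (\<Sum>b\<in>B. representation B (\<phi> k) b * ip (\<phi> k) b)" for k
  proof -
    have "\<phi> k = (\<Sum>b\<in>B. smul (representation B (\<phi> k) b) b)"
      using sum_representation_eq[OF B(1) mem fin] by simp
    then have "ip (\<phi> k) (\<phi> k) = ip (\<phi> k) (\<Sum>b\<in>B. smul (representation B (\<phi> k) b) b)"
      by simp
    then show ?thesis by (simp add: ip_sum_right ip_scale_right)
  qed
  then have "(\<Sum>k\<in>UNIV. ip (\<phi> k) (\<phi> k)) =
      (\<Sum>b\<in>B. \<Sum>k\<in>UNIV. representation B (\<phi> k) b * ip (\<phi> k) b)"
    by (simp add: sum.swap[of _ B])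
  \<comment> \<open>The frame operator sends \<open>b\<close> to the sum of the
    \<open>\<phi> k\<close> weighted by \<open>ip (\<phi> k) b\<close>, so the inner sum is the
    coordinate of that image at \<open>b\<close>.\<close>
  also have "\<dots> = (\<Sum>b\<in>B. representation B (frame_operator smul ip \<phi> b) b)"
    by (simp add: frame_operator_sum representation_sum[OF B(1)] representation_scale[OF B(1)]
        span_scale mem mult.commute)
  finally show ?thesis .
qed

text \<open>Let \<open>u\<close> be the image of \<open>x\<close> under synthesis and G the Gram
  operator. Regrouping the four factors of G^2, the adjoint sends the difference to G^2 x - c G x,
  which vanishes.\<close>

lemma frame_operator_minus_scale_in_kernel:
  assumes gram: "gram_operator smul ip \<phi> ^^ 2 = (\<lambda>x. c *s gram_operator smul ip \<phi> x)"
    and u: "u \<in> span (range \<phi>)"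
  shows "frame_operator smul ip \<phi> u - smul c u
    \<in> {u \<in> span (range \<phi>). synthesis_adjoint ip \<phi> u = 0}"
proof -
  obtain x where x: "u = synthesis smul \<phi> x"
    using u unfolding range_synthesis[symmetric] by blast
  have "synthesis_adjoint ip \<phi> (frame_operator smul ip \<phi> u) = (gram_operator smul ip \<phi> ^^ 2) x"
    by (simp add: x gram_operator_def frame_operator_def numeral_2_eq_2)
  also have "\<dots> = c *s synthesis_adjoint ip \<phi> u"
    by (simp only: gram) (simp add: x gram_operator_def)
  finally have "synthesis_adjoint ip \<phi> (frame_operator smul ip \<phi> u - smul c u) = 0"
    by (simp add: synthesis_adjoint_def vec_eq_iff ip_diff_right ip_scale_right)
  then show ?thesis
    using u by (simp add: span_diff span_scale frame_operator_in_span)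
qed

lemma adjoint_kernel_trivial:
  assumes gram: "gram_operator smul ip \<phi> ^^ 2 = (\<lambda>x. c *s gram_operator smul ip \<phi> x)"
    and trace: "(\<Sum>k\<in>UNIV. ip (\<phi> k) (\<phi> k)) = c * of_nat (dim (range \<phi>))"
    and c: "c \<noteq> 0" and char: "dim (range \<phi>) < CHAR('f)"
    and u: "u \<in> span (range \<phi>)" "synthesis_adjoint ip \<phi> u = 0"
  shows "u = 0"
proof -
  let ?S = "frame_operator smul ip \<phi>"
  define K where "K = {u \<in> span (range \<phi>). synthesis_adjoint ip \<phi> u = 0}"
  obtain A where A: "A \<subseteq> K" "independent A" "K \<subseteq> span A"
    using maximal_independent_subset by blast
  have "A \<subseteq> span (range \<phi>)" using A(1) by (auto simp: K_def)
  then obtain B where B: "A \<subseteq> B" "B \<subseteq> span (range \<phi>)" "independent B"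
    "span (range \<phi>) \<subseteq> span B"
    using maximal_independent_subset_extend[OF _ A(2)] by blast
  have spanB: "span (range \<phi>) = span B"
    using B(2,4) by (metis span_minimal subspace_span subset_antisym)
  have fin: "finite B" using B(3) by (rule finiteI_independent)
  have dimB: "dim (range \<phi>) = card B"
    by (metis B(3) spanB dim_span dim_eq_card_independent)
  \<comment> \<open>In the basis \<open>B\<close> the operator is block triangular: it kills
    \<open>A\<close> and sends every other \<open>b\<close> to \<open>smul c b\<close> plus an
    element of \<open>span A\<close>.\<close>
  have diag: "representation B (?S b) b = (if b \<in> A then 0 else c)" if b: "b \<in> B" for b
  proof (cases "b \<in> A")
    case True
    then have "?S b = 0"
      using A(1) by (auto simp: K_def frame_operator_def synthesis_def)
    then show ?thesis using True by (simp add: representation_zero)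
  next
    case False
    have bU: "b \<in> span (range \<phi>)" using B(2) b by blast
    have "?S b - smul c b \<in> span A"
      using frame_operator_minus_scale_in_kernel[OF gram bU] A(3) by (auto simp: K_def)
    \<comment> \<open>Elements of \<open>span A\<close> keep their coordinates in the larger basis
      \<open>B\<close>, hence have none at \<open>b\<close> outside \<open>A\<close>.\<close>
    then have "representation B (?S b - smul c b) b = 0"
      using representation_extend[OF B(3) _ B(1)] False
      by (metis representation_ne_zero)
    moreover have "representation B (?S b - smul c b) b
        = representation B (?S b) b - c * representation B b b"
      using bU frame_operator_in_span[of \<phi> b] spanB
      by (simp add: representation_diff[OF B(3)] representation_scale[OF B(3)] span_scale)
    ultimately show ?thesis
      using False by (simp add: representation_basis[OF B(3) b])
  qed
  have "c * of_nat (card B) = (\<Sum>b\<in>B. if b \<in> A then 0 else c)"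
    using trace gram_trace_eq_frame_trace[OF B(3) spanB] diag dimB by simp
  also have "\<dots> = (\<Sum>b\<in>B - A. c)"
    by (rule sum.mono_neutral_cong_right) (use fin in auto)
  also have "\<dots> = c * of_nat (card (B - A))"
    by simp
  \<comment> \<open>This compares the two cardinalities only modulo the characteristic;
    \<open>card A \<le> d < CHAR('f)\<close> then turns divisibility into
    \<open>card A = 0\<close>.\<close>
  finally have "of_nat (card B) = (of_nat (card (B - A)) :: 'f)"
    using c by simp
  moreover have "card B = card (B - A) + card A"
    using B(1) fin by (metis add.commute card_Diff_subset card_mono finite_subset le_add_diff_inverse)
  ultimately have "of_nat (card A) = (0 :: 'f)" by simp
  then have "CHAR('f) dvd card A" by (simp add: of_nat_eq_0_iff_char_dvd)
  moreover have "card A < CHAR('f)"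
    using card_mono[OF fin B(1)] char dimB by simp
  ultimately have "card A = 0" by (metis dvd_imp_le gr0I not_le)
  then have "A = {}" using B(1) fin finite_subset by fastforce
  then show ?thesis using A(3) u by (auto simp: K_def)
qed

end

theorem theorem5p7:
  fixes smul :: "'f::field \<Rightarrow> 'v::ab_group_add \<Rightarrow> 'v" and Basis :: "'v set"
    and \<sigma> :: "'f \<Rightarrow> 'f" and ip :: "'v \<Rightarrow> 'v \<Rightarrow> 'f"
    and \<phi> :: "'n::finite \<Rightarrow> 'v" and a c :: 'f and d :: nat
  assumes "non_isotropic_space smul Basis \<sigma> ip"
    and "\<And>j. ip (\<phi> j) (\<phi> j) = a"
    and "d = vector_space.dim smul (range (synthesis smul \<phi>))"
    and "c = of_nat CARD('n) * a / of_nat d"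
    and "c \<noteq> 0"
    and "CHAR('f) > d"
    and "gram_operator smul ip \<phi> ^^ 2 = (\<lambda>x. c *s gram_operator smul ip \<phi> x)"
  shows "non_isotropic_subspace smul ip (range (synthesis smul \<phi>)) \<and>
         tight_frame smul ip \<phi> c (range (synthesis smul \<phi>))"
proof -
  interpret non_isotropic_space smul Basis \<sigma> ip by fact
  have d: "d = dim (range \<phi>)"
    using assms(3) by (simp add: range_synthesis)
  \<comment> \<open>Division by zero has value 0, so a vanishing denominator would force
    \<open>c = 0\<close>.\<close>
  have "of_nat d \<noteq> (0 :: 'f)"
    using assms(4,5) by auto
  then have trace: "(\<Sum>k\<in>UNIV. ip (\<phi> k) (\<phi> k)) = c * of_nat (dim (range \<phi>))"
    using assms(2,4) d by simp
  have inj: "u = 0" if "u \<in> span (range \<phi>)" "synthesis_adjoint ip \<phi> u = 0" for u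
    using adjoint_kernel_trivial[OF assms(7) trace assms(5) _ that] assms(6) d by simp
  have "u = 0" if "u \<in> span (range \<phi>)" "\<forall>v\<in>span (range \<phi>). ip u v = 0" for u
  proof (rule inj[OF that(1)])
    have "ip (\<phi> j) u = 0" for j
    proof -
      have "ip u (\<phi> j) = 0" using that(2) by (simp add: span_base)
      \<comment> \<open>Hermitian symmetry swaps the arguments at the cost of
        \<open>\<sigma>\<close>, which fixes 0 by additivity.\<close>
      then have "ip (\<phi> j) u = \<sigma> 0" using ip_hermitian by metis
      then show ?thesis by (metis add_0 add_cancel_right_right sigma_add)
    qed
    then show "synthesis_adjoint ip \<phi> u = 0"
      by (simp add: synthesis_adjoint_def vec_eq_iff)
  qed
  then have "non_isotropic_subspace smul ip (span (range \<phi>))"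
    unfolding non_isotropic_subspace_def by auto
  moreover have "frame_operator smul ip \<phi> u = smul c u" if "u \<in> span (range \<phi>)" for u
    using inj[of "frame_operator smul ip \<phi> u - smul c u"]
      frame_operator_minus_scale_in_kernel[OF assms(7) that] by simp
  ultimately show ?thesis
    unfolding tight_frame_def range_synthesis by simp
qed

end
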